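(* Let $UB$ be the objective-function value of the best-known feasible solution of the integer bilevel nonlinear program. Let furthermore $\bar U_i$ be the optimal objective-function value of the problem $$\min\{c'x+d'y:(x,y)\in\mathcal P\cap\mathcal D_i(\hat y)\cap\mathbb Z^n\}.$$ If $\bar U_i\ge UB$, then the disjunction $\mathcal D_i(\hat y)$ is redundant and can be discarded from $\mathcal D(\hat y,\mathcal P)$ and thus also from (CG-SOCP).
   Context: **Bilevel program.** Prime denotes transpose, $n=n_1+n_2$. The integer bilevel nonlinear program is $$\min\ c'x+d'y\quad\text{s.t. } Mx+Ny\ge h,\ \ \tilde Mx+\tilde Ny-\tilde h\in\mathcal K,\ \ y\in\Omega(x),\ \ x\in\mathbb Z^{n_1},$$ where $\Omega(x)$ is the set of optimal solutions of the follower problem $\min\{q(y): Ax+By\ge f,\ y\in\mathcal Y,\ y\in\mathbb Z^{n_2}\}$. Here $A\in\mathbb Z^{m_2\times n_1}$, $B\in\mathbb Z^{m_2\times n_2}$, $f\in\mathbb Z^{m_2}$ with $i$-th rows/entries $A^i,B^i,f_i$ (each $A^i$ and $B^i$ has a nonzero entry); the other data are real; $\mathcal K$ is a cross-product of second-order cones; $\mathcal Y$ is a polyhedron; $q(y)=y'Ry+g'y$ with $R=V'V$, $V\in\mathbb R^{n_3\times n_2}$, $n_3\le n_2$. A point $(x,y)\in\mathbb R^n$ is (bilevel) feasible if it satisfies all constraints of the program. **Relaxation.** $\overline{\mathrm{HPR}}$ is the problem of minimizing $c'x+d'y$ over the real points $(x,y)$ satisfying $Mx+Ny\ge h$, $\tilde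 Mx+\tilde Ny-\tilde h\in\mathcal K$, $Ax+By\ge f$, $y\in\mathcal Y$ and the variable bounds. Standing assumptions: all variables are bounded and $\mathcal Y$ is bounded; $\overline{\mathrm{HPR}}$ has a feasible solution satisfying the conic constraint strictly, and its dual has a feasible solution. **Disjunctions.** $\mathcal P=\{(x,y):\bar Mx+\bar Ny\ge\bar h,\ \tilde Mx+\tilde Ny-\tilde h\in\mathcal K\}$ is a second-order conic convex set that is a subset of the feasible set of $\overline{\mathrm{HPR}}$, and $\hat y\in\mathcal Y\cap\mathbb Z^{n_2}$. $\mathcal D_0(\hat y)$ is the condition (and the set of $(x,y)$ satisfying it) $q(y)\le q(\hat y)$; for $i=1,\dots,m_2$, $\mathcal D_i(\hat y)$ is $A^ix\le f_i-B^i\hat y-1$. Every bilevel-feasible point satisfies at least one of $\mathcal D_0(\hat y),\dots,\mathcal D_{m_2}(\hat y)$. Put $\mathcal D(\hat y,\mathcal P)=\operatorname{conv}\big(\bigcup_{i=0}^{m_2}(\mathcal P\cap\mathcal D_i(\hat y))\big)$. In the statement, $i$ is the index of one of these disjunctions. **(CG-SOCP)** is the second-order cone program that, for a bilevel-infeasible point $(x^*,y^* )\in\mathcal P$, maximizes $\tau-\alpha'x^*-\beta'y^*$ over the $(\alpha,\beta,\tau)$ (together with dual multipliers certifying validity for each set $\mathcal P\cap\mathcal D_i(\hat y)$, $i=0,\dots,m_2$) for which $\alpha'x+\beta'y\ge\tau$ is a valid linear inequality for $\mathcal D(\hat y,\mathcal P)$; a positive objective value gives a disjunctive cut separating $(x^*,y^*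 )$ from $\mathcal D(\hat y,\mathcal P)$. **Redundancy (optimality-based).** $\mathcal D_i(\hat y)$ is redundant if among the solutions in $\mathcal P\cap\mathcal D_i(\hat y)\cap\mathbb Z^n$ there is no solution that improves the current best leader objective-function value $UB$. Discarding $\mathcal D_i(\hat y)$ means leaving it out of the union defining $\mathcal D(\hat y,\mathcal P)$ and leaving the corresponding constraints and multipliers out of (CG-SOCP). *)

theory Defs
  imports "HOL-Analysis.Analysis"
begin

(* A program with a finite nonempty type of row indices per constraint system. The cone is a
   product of second-order cones: block maps each cone coordinate to the factor it belongs to,
   and apex selects the coordinate of a factor that bounds the norm of the others. *)
record ('n1::finite, 'n2::finite, 'n3::finite, 'm1::finite, 'm2::finite,
        'k::finite, 'p::finite, 'r::finite) bilevel =
  obj_x :: "real^'n1"           (* c *)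
  obj_y :: "real^'n2"           (* d *)
  lin_x :: "real^'n1^'m1"       (* M *)
  lin_y :: "real^'n2^'m1"       (* N *)
  lin_rhs :: "real^'m1"         (* h *)
  con_x :: "real^'n1^'k"        (* M tilde *)
  con_y :: "real^'n2^'k"        (* N tilde *)
  con_rhs :: "real^'k"          (* h tilde *)
  block :: "'k \<Rightarrow> 'p"
  apex :: "'p \<Rightarrow> 'k"
  fol_x :: "real^'n1^'m2"       (* A *)
  fol_y :: "real^'n2^'m2"       (* B *)
  fol_rhs :: "real^'m2"         (* f *)
  quad_fac :: "real^'n2^'n3"    (* V *)
  quad_lin :: "real^'n2"        (* g *)
  poly_mat :: "real^'n2^'r"     (* the polyhedron is poly_mat y >= poly_rhs *)
  poly_rhs :: "real^'r"
  x_lo :: "real^'n1"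
  x_up :: "real^'n1"
  y_lo :: "real^'n2"
  y_up :: "real^'n2"

definition integral_vec :: "real^'n \<Rightarrow> bool" where
  "integral_vec v \<longleftrightarrow> (\<forall>j. v $ j \<in> \<int>)"

definition integer_points :: "((real^'n1) \<times> (real^'n2)) set" where
  "integer_points = {(x, y). integral_vec x \<and> integral_vec y}"

definition soc_product :: "('k::finite \<Rightarrow> 'p) \<Rightarrow> ('p \<Rightarrow> 'k) \<Rightarrow> (real^'k) set" where
  "soc_product bl ap =
     {z. \<forall>p. sqrt (\<Sum>j\<in>{j. bl j = p \<and> j \<noteq> ap p}. (z $ j)\<^sup>2) \<le> z $ ap p}"

abbreviation cone where
  "cone D \<equiv> soc_product (block D) (apex D)"

definition leader_obj where
  "leader_obj D = (\<lambda>(x, y). obj_x D \<bullet> x + obj_y D \<bullet> y)"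

definition follower_obj where
  "follower_obj D y = y \<bullet> ((transpose (quad_fac D) ** quad_fac D) *v y) + quad_lin D \<bullet> y"

definition linear_con where
  "linear_con D = {(x, y). lin_rhs D \<le> lin_x D *v x + lin_y D *v y}"

definition conic_con where
  "conic_con D = {(x, y). con_x D *v x + con_y D *v y - con_rhs D \<in> cone D}"

definition strict_conic_con where
  "strict_conic_con D =
     {(x, y). con_x D *v x + con_y D *v y - con_rhs D \<in> interior (cone D)}"

definition follower_con where
  "follower_con D = {(x, y). fol_rhs D \<le> fol_x D *v x + fol_y D *v y}"

definition follower_poly where
  "follower_poly D = {y. poly_rhs D \<le> poly_mat D *v y}"

definition bounds_con where
  "bounds_con D = {(x, y). x_lo D \<le> x \<and> x \<le> x_up D \<and> y_lo D \<le> y \<and> y \<le> y_up D}"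

definition follower_feasible where
  "follower_feasible D x =
     {y. (x, y) \<in> follower_con D \<and> y \<in> follower_poly D \<and> integral_vec y}"

definition follower_optimal where
  "follower_optimal D x =
     {y \<in> follower_feasible D x.
        \<forall>y' \<in> follower_feasible D x. follower_obj D y \<le> follower_obj D y'}"

definition bilevel_feasible where
  "bilevel_feasible D =
     {(x, y). (x, y) \<in> linear_con D \<and> (x, y) \<in> conic_con D \<and>
        y \<in> follower_optimal D x \<and> integral_vec x}"

definition hpr_feasible where
  "hpr_feasible D =
     {(x, y). (x, y) \<in> linear_con D \<and> (x, y) \<in> conic_con D \<and> (x, y) \<in> follower_con D \<and>
        y \<in> follower_poly D \<and> (x, y) \<in> bounds_con D}"

(* Feasibility of the conic dual of the relaxation; second-order cones are self-dual, so the
   multipliers of the conic constraint range over the cone itself. *)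
definition hpr_dual_feasible where
  "hpr_dual_feasible D \<longleftrightarrow>
     (\<exists>u v r s xl xu yl yu.
        0 \<le> u \<and> v \<in> cone D \<and> 0 \<le> r \<and> 0 \<le> s \<and> 0 \<le> xl \<and> 0 \<le> xu \<and> 0 \<le> yl \<and> 0 \<le> yu \<and>
        u v* lin_x D + v v* con_x D + r v* fol_x D + xl - xu = obj_x D \<and>
        u v* lin_y D + v v* con_y D + r v* fol_y D + s v* poly_mat D + yl - yu = obj_y D)"

definition standing_assumptions ::
  "('n1::finite, 'n2::finite, 'n3::finite, 'm1::finite, 'm2::finite,
    'k::finite, 'p::finite, 'r::finite) bilevel \<Rightarrow> bool" where
  "standing_assumptions D \<longleftrightarrow>
     (\<forall>p. block D (apex D p) = p) \<and>
     (\<forall>i. integral_vec (fol_x D $ i) \<and> integral_vec (fol_y D $ i)) \<and>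
     integral_vec (fol_rhs D) \<and>
     (\<forall>i. fol_x D $ i \<noteq> 0 \<and> fol_y D $ i \<noteq> 0) \<and>
     CARD('n3) \<le> CARD('n2) \<and>
     bilevel_feasible D \<subseteq> bounds_con D \<and>
     bounded (follower_poly D) \<and>
     hpr_feasible D \<inter> strict_conic_con D \<noteq> {} \<and>
     hpr_dual_feasible D"

(* The set P, with linear data M bar, N bar, h bar. *)
definition node_set where
  "node_set D Mb Nb hb = {(x, y). hb \<le> Mb *v x + Nb *v y} \<inter> conic_con D"

(* None is the disjunction with index 0; Some i is the one obtained from follower row i. *)
definition disjunction ::
  "('n1::finite, 'n2::finite, 'n3::finite, 'm1::finite, 'm2::finite,
    'k::finite, 'p::finite, 'r::finite) bilevel
    \<Rightarrow> real^'n2 \<Rightarrow> 'm2 option \<Rightarrow> ((real^'n1) \<times> (real^'n2)) set" where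
  "disjunction D yh i =
     (case i of
        None \<Rightarrow> {(x, y). follower_obj D y \<le> follower_obj D yh}
      | Some j \<Rightarrow> {(x, y). fol_x D $ j \<bullet> x \<le> fol_rhs D $ j - fol_y D $ j \<bullet> yh - 1})"

(* I is the set of indices kept in the disjunction; UNIV gives the full hull. *)
definition disj_hull where
  "disj_hull D yh P I = convex hull (\<Union>i\<in>I. P \<inter> disjunction D yh i)"

(* Optimal value of the leader objective over the integer points of P in a disjunction;
   it is infinite if there are none. *)
definition disj_opt :: "_ \<Rightarrow> _ \<Rightarrow> _ \<Rightarrow> _ \<Rightarrow> ereal" where
  "disj_opt D yh P i =
     (INF z \<in> P \<inter> disjunction D yh i \<inter> integer_points. ereal (leader_obj D z))"

definition redundant where
  "redundant D yh P UB i \<longleftrightarrow>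
     \<not> (\<exists>z \<in> P \<inter> disjunction D yh i \<inter> integer_points. leader_obj D z < UB)"

definition ineq_holds :: "(real^'n1) \<times> (real^'n2) \<times> real \<Rightarrow> (real^'n1) \<times> (real^'n2) \<Rightarrow> bool" where
  "ineq_holds = (\<lambda>(\<alpha>, \<beta>, \<tau>) (x, y). \<tau> \<le> \<alpha> \<bullet> x + \<beta> \<bullet> y)"

(* With V = quad_fac D, g = quad_lin D and t = follower_obj D yh - g . y, the condition
   follower_obj D y <= follower_obj D yh reads |V y|^2 <= t, which is the second-order cone
   constraint |(V y, (1 - t)/2)| <= (1 + t)/2. *)
lemma disjunction_None_iff_soc:
  "(x, y) \<in> disjunction D yh None \<longleftrightarrow>
     norm (quad_fac D *v y, (1 - (follower_obj D yh - quad_lin D \<bullet> y)) / 2)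
       \<le> (1 + (follower_obj D yh - quad_lin D \<bullet> y)) / 2"
proof -
  define t where "t = follower_obj D yh - quad_lin D \<bullet> y"
  define w where "w = quad_fac D *v y"
  have q: "follower_obj D y = w \<bullet> w + quad_lin D \<bullet> y"
    unfolding follower_obj_def w_def
    by (simp add: matrix_vector_mul_assoc[symmetric] dot_lmul_matrix[symmetric] inner_commute)
  have n2: "(norm (w, (1 - t) / 2))\<^sup>2 = w \<bullet> w + ((1 - t) / 2)\<^sup>2"
    unfolding power2_norm_eq_inner by (simp add: power2_eq_square)
  have sq: "w \<bullet> w + ((1 - t) / 2)\<^sup>2 \<le> ((1 + t) / 2)\<^sup>2 \<longleftrightarrow> w \<bullet> w \<le> t"
    by (simp add: power2_eq_square field_simps)
  have "norm (w, (1 - t) / 2) \<le> (1 + t) / 2 \<longleftrightarrow> w \<bullet> w \<le> t"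
  proof
    assume "norm (w, (1 - t) / 2) \<le> (1 + t) / 2"
    then have "(norm (w, (1 - t) / 2))\<^sup>2 \<le> ((1 + t) / 2)\<^sup>2"
      by (rule power_mono) simp
    then show "w \<bullet> w \<le> t" using n2 sq by simp
  next
    assume wt: "w \<bullet> w \<le> t"
    then have "0 \<le> (1 + t) / 2" using inner_ge_zero[of w] by (simp del: inner_ge_zero)
    moreover have "(norm (w, (1 - t) / 2))\<^sup>2 \<le> ((1 + t) / 2)\<^sup>2"
      using n2 sq wt by simp
    ultimately show "norm (w, (1 - t) / 2) \<le> (1 + t) / 2"
      by (rule power2_le_imp_le[rotated])
  qed
  then show ?thesis
    by (auto simp: disjunction_def q t_def w_def)
qed

(* Multipliers u, v belong to the linear and the conic constraints of P; (w0, w, w1) to the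
   second-order cone constraint above; s to the linear inequality of a follower row. *)
definition certified where
  "certified D Mb Nb hb yh i = (\<lambda>(\<alpha>, \<beta>, \<tau>).
     \<exists>u v. 0 \<le> u \<and> v \<in> cone D \<and>
       (case i of
          None \<Rightarrow>
            (\<exists>w0 w w1. norm (w, w1) \<le> w0 \<and>
               \<alpha> = u v* Mb + v v* con_x D \<and>
               \<beta> = u v* Nb + v v* con_y D + w v* quad_fac D + ((w1 - w0) / 2) *\<^sub>R quad_lin D \<and>
               \<tau> \<le> u \<bullet> hb + v \<bullet> con_rhs D
                     - w0 * (1 + follower_obj D yh) / 2 - w1 * (1 - follower_obj D yh) / 2)
        | Some j \<Rightarrow>
            (\<exists>s::real. 0 \<le> s \<and>
               \<alpha> = u v* Mb + v v* con_x D - s *\<^sub>R fol_x D $ j \<and>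
               \<beta> = u v* Nb + v v* con_y D \<and>
               \<tau> \<le> u \<bullet> hb + v \<bullet> con_rhs D
                     - s * (fol_rhs D $ j - fol_y D $ j \<bullet> yh - 1))))"

(* Feasible set (projected to the cut coefficients) and objective of the cut generating SOCP;
   only the disjunctions with index in I contribute constraints and multipliers. *)
definition cg_feasible where
  "cg_feasible D Mb Nb hb yh I = {cut. \<forall>i\<in>I. certified D Mb Nb hb yh i cut}"

definition cg_objective :: "(real^'n1) \<times> (real^'n2) \<Rightarrow> (real^'n1) \<times> (real^'n2) \<times> real \<Rightarrow> real" where
  "cg_objective = (\<lambda>(xs, ys) (\<alpha>, \<beta>, \<tau>). \<tau> - \<alpha> \<bullet> xs - \<beta> \<bullet> ys)"

end

theory Submission
  imports Defs
begin

text \<open>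
  A bilevel feasible point satisfies some disjunction: either \<open>yh\<close> violates a follower row, and then
  by integrality by at least one unit, or \<open>yh\<close> is a feasible response and optimality of \<open>y\<close> bounds
  its value. A point better than \<open>UB\<close> cannot satisfy disjunction \<open>i\<close>, hence it satisfies another
  one. Certified inequalities are valid by weak conic duality, because a second-order cone lies in
  its own dual; validity passes to the convex hull since a half-space is convex.
\<close>

text \<open>Splitting the inner product along the factors of the cone leaves one estimate per block:
  by Cauchy-Schwarz the non-apex coordinates contribute at least minus the product of the two apex
  entries.\<close>

lemma soc_product_inner_nonneg:
  fixes v z :: "real^'k::finite" and bl :: "'k \<Rightarrow> 'p::finite"
  assumes apex: "\<And>p. bl (ap p) = p"
    and v: "v \<in> soc_product bl ap" and z: "z \<in> soc_product bl ap"
  shows "0 \<le> v \<bullet> z"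
proof -
  have block_nonneg: "0 \<le> (\<Sum>j\<in>{j. bl j = p}. v $ j * z $ j)" for p
  proof -
    let ?T = "{j. bl j = p \<and> j \<noteq> ap p}"
    have vp: "L2_set (($) v) ?T \<le> v $ ap p" and zp: "L2_set (($) z) ?T \<le> z $ ap p"
      using v z by (auto simp: soc_product_def L2_set_def)
    have "- (\<Sum>j\<in>?T. v $ j * z $ j) \<le> (\<Sum>j\<in>?T. \<bar>v $ j\<bar> * \<bar>z $ j\<bar>)"
      unfolding sum_negf[symmetric] abs_mult[symmetric] by (rule sum_mono) (rule abs_ge_minus_self)
    also have "\<dots> \<le> L2_set (($) v) ?T * L2_set (($) z) ?T"
      by (rule L2_set_mult_ineq)
    also have "\<dots> \<le> v $ ap p * z $ ap p"
      using vp zp by (intro mult_mono) (auto intro: order_trans[OF L2_set_nonneg])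
    finally have "0 \<le> v $ ap p * z $ ap p + (\<Sum>j\<in>?T. v $ j * z $ j)"
      by simp
    also have "\<dots> = (\<Sum>j\<in>insert (ap p) ?T. v $ j * z $ j)"
      by simp
    \<comment> \<open>By \<open>apex\<close>, the apex coordinate of a factor lies in its own block,
      so adding it back completes the block.\<close>
    also have "insert (ap p) ?T = {j. bl j = p}"
      using apex by auto
    finally show ?thesis .
  qed
  have "v \<bullet> z = (\<Sum>j\<in>UNIV. v $ j * z $ j)"
    by (simp add: inner_vec_def)
  also have "\<dots> = (\<Sum>p\<in>UNIV. \<Sum>j\<in>{j. bl j = p}. v $ j * z $ j)"
    using sum.group[of UNIV UNIV bl "\<lambda>j. v $ j * z $ j"] by simp
  finally show ?thesis
    by (simp add: block_nonneg sum_nonneg)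
qed

lemma inner_vec_mono:
  fixes u a b :: "real^'n"
  assumes "0 \<le> u" and "a \<le> b"
  shows "u \<bullet> a \<le> u \<bullet> b"
  using assms unfolding inner_vec_def less_eq_vec_def
  by (auto intro!: sum_mono mult_left_mono)

lemma integral_vec_inner:
  assumes "integral_vec a" and "integral_vec b"
  shows "a \<bullet> b \<in> \<int>"
  using assms unfolding inner_vec_def integral_vec_def by (auto intro!: Ints_sum Ints_mult)

text \<open>This is the source of the \<open>- 1\<close> in the disjunctions of the follower
  rows.\<close>

lemma Ints_less_imp_le_minus_one:
  fixes a b :: real
  assumes "a \<in> \<int>" and "b \<in> \<int>" and "a < b"
  shows "a \<le> b - 1"
  using assms by (auto elim!: Ints_cases)

text \<open>Pairing each constraint with its multiplier and adding up gives
  \<open>\<alpha> \<bullet> x + \<beta> \<bullet> y\<close> on one side and the bound on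
  \<open>\<tau>\<close> on the other. The parts from \<open>u\<close> and \<open>v\<close> are
  common to all indices; only the last summand depends on \<open>i\<close>.\<close>

lemma certified_imp_ineq_holds:
  assumes apex: "\<And>p. block D (apex D p) = p"
    and cert: "certified D Mb Nb hb yh i ineq"
    and zP: "z \<in> node_set D Mb Nb hb" and zD: "z \<in> disjunction D yh i"
  shows "ineq_holds ineq z"
proof -
  obtain \<alpha> \<beta> \<tau> where ineq: "ineq = (\<alpha>, \<beta>, \<tau>)"
    by (metis prod_cases3)
  obtain x y where z: "z = (x, y)"
    by fastforce
  obtain u v where u: "0 \<le> u" and v: "v \<in> cone D"
    and mult: "case i of
          None \<Rightarrow>
            (\<exists>w0 w w1. norm (w, w1) \<le> w0 \<and>
               \<alpha> = u v* Mb + v v* con_x D \<and>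
               \<beta> = u v* Nb + v v* con_y D + w v* quad_fac D + ((w1 - w0) / 2) *\<^sub>R quad_lin D \<and>
               \<tau> \<le> u \<bullet> hb + v \<bullet> con_rhs D
                     - w0 * (1 + follower_obj D yh) / 2 - w1 * (1 - follower_obj D yh) / 2)
        | Some j \<Rightarrow>
            (\<exists>s::real. 0 \<le> s \<and>
               \<alpha> = u v* Mb + v v* con_x D - s *\<^sub>R fol_x D $ j \<and>
               \<beta> = u v* Nb + v v* con_y D \<and>
               \<tau> \<le> u \<bullet> hb + v \<bullet> con_rhs D
                     - s * (fol_rhs D $ j - fol_y D $ j \<bullet> yh - 1))"
    using cert unfolding certified_def ineq by auto
  have lin: "hb \<le> Mb *v x + Nb *v y"
    and con: "con_x D *v x + con_y D *v y - con_rhs D \<in> cone D"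
    using zP by (auto simp: node_set_def conic_con_def z)
  have lin_le: "u \<bullet> hb \<le> u \<bullet> (Mb *v x) + u \<bullet> (Nb *v y)"
    using inner_vec_mono[OF u lin] by (simp add: inner_add_right)
  have con_le: "v \<bullet> con_rhs D \<le> v \<bullet> (con_x D *v x) + v \<bullet> (con_y D *v y)"
    using soc_product_inner_nonneg[of "block D" "apex D", OF apex v con]
    by (simp add: inner_add_right inner_diff_right)
  show ?thesis
  proof (cases i)
    case None
    then obtain w0 w w1 where w: "norm (w, w1) \<le> w0"
      and \<alpha>: "\<alpha> = u v* Mb + v v* con_x D"
      and \<beta>: "\<beta> = u v* Nb + v v* con_y D + w v* quad_fac D + ((w1 - w0) / 2) *\<^sub>R quad_lin D"
      and \<tau>: "\<tau> \<le> u \<bullet> hb + v \<bullet> con_rhs D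
                     - w0 * (1 + follower_obj D yh) / 2 - w1 * (1 - follower_obj D yh) / 2"
      using mult by auto
    \<comment> \<open>With this \<open>t\<close>, disjunction 0 is cone membership, and
      \<open>(w0, w, w1)\<close> is a multiplier from the same self-dual cone.\<close>
    define t where "t = follower_obj D yh - quad_lin D \<bullet> y"
    have soc: "norm (quad_fac D *v y, (1 - t) / 2) \<le> (1 + t) / 2"
      using zD unfolding z None disjunction_None_iff_soc t_def .
    have "- ((w, w1) \<bullet> (quad_fac D *v y, (1 - t) / 2))
        \<le> norm (w, w1) * norm (quad_fac D *v y, (1 - t) / 2)"
      using Cauchy_Schwarz_ineq2[of "(w, w1)" "(quad_fac D *v y, (1 - t) / 2)"] by linarith
    also have "\<dots> \<le> w0 * ((1 + t) / 2)"
      using w soc by (intro mult_mono) (auto intro: order_trans[OF norm_ge_zero])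
    finally have "0 \<le> w \<bullet> (quad_fac D *v y) + w1 * ((1 - t) / 2) + w0 * ((1 + t) / 2)"
      by simp
    \<comment> \<open>Substituting \<open>t\<close> splits the pairing: the terms in
      \<open>follower_obj D yh\<close> are constants and belong to \<open>\<tau>\<close>, while the
      coefficient \<open>(w1 - w0) / 2\<close> of \<open>quad_lin D \<bullet> y\<close> belongs to
      \<open>\<beta>\<close>.\<close>
    then have soc_le: "- (w0 * (1 + follower_obj D yh) / 2) - w1 * (1 - follower_obj D yh) / 2
        \<le> w \<bullet> (quad_fac D *v y) + ((w1 - w0) / 2) * (quad_lin D \<bullet> y)"
      unfolding t_def by (simp add: field_simps)
    have "\<alpha> \<bullet> x + \<beta> \<bullet> y = u \<bullet> (Mb *v x) + u \<bullet> (Nb *v y) + (v \<bullet> (con_x D *v x) + v \<bullet> (con_y D *v y))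
        + (w \<bullet> (quad_fac D *v y) + ((w1 - w0) / 2) * (quad_lin D \<bullet> y))"
      unfolding \<alpha> \<beta> by (simp add: inner_add_left dot_lmul_matrix)
    then show ?thesis
      using \<tau> lin_le con_le soc_le unfolding ineq_holds_def ineq z by simp
  next
    case (Some j)
    then obtain s where s: "0 \<le> s"
      and \<alpha>: "\<alpha> = u v* Mb + v v* con_x D - s *\<^sub>R fol_x D $ j"
      and \<beta>: "\<beta> = u v* Nb + v v* con_y D"
      and \<tau>: "\<tau> \<le> u \<bullet> hb + v \<bullet> con_rhs D - s * (fol_rhs D $ j - fol_y D $ j \<bullet> yh - 1)"
      using mult by auto
    have "fol_x D $ j \<bullet> x \<le> fol_rhs D $ j - fol_y D $ j \<bullet> yh - 1"
      using zD by (simp add: disjunction_def z Some)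
    \<comment> \<open>The row disjunction is an upper bound, hence the negative sign of
      \<open>s\<close> in both \<open>\<alpha>\<close> and the bound on
      \<open>\<tau>\<close>.\<close>
    then have row_le: "s * (fol_x D $ j \<bullet> x) \<le> s * (fol_rhs D $ j - fol_y D $ j \<bullet> yh - 1)"
      using s by (rule mult_left_mono)
    have "\<alpha> \<bullet> x + \<beta> \<bullet> y = u \<bullet> (Mb *v x) + u \<bullet> (Nb *v y) + (v \<bullet> (con_x D *v x) + v \<bullet> (con_y D *v y))
        - s * (fol_x D $ j \<bullet> x)"
      unfolding \<alpha> \<beta> by (simp add: inner_add_left inner_diff_left dot_lmul_matrix)
    then show ?thesis
      using \<tau> lin_le con_le row_le unfolding ineq_holds_def ineq z by simp
  qed
qed

lemma convex_ineq_holds: "convex {z. ineq_holds ineq z}"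
proof -
  obtain \<alpha> \<beta> \<tau> where ineq: "ineq = (\<alpha>, \<beta>, \<tau>)"
    by (metis prod_cases3)
  have "{z. ineq_holds ineq z} = {z. (\<alpha>, \<beta>) \<bullet> z \<ge> \<tau>}"
    by (auto simp: ineq_holds_def ineq)
  then show ?thesis
    by (simp add: convex_halfspace_ge)
qed

text \<open>The certificates for the indices in \<open>I\<close> share one cut, so its half-space
  contains the whole union. As \<open>I\<close> is arbitrary, dropping an index shrinks the hull and
  the constraint system consistently.\<close>

lemma cg_feasible_valid_on_hull:
  assumes "\<And>p. block D (apex D p) = p"
    and "ineq \<in> cg_feasible D Mb Nb hb yh I"
    and "z \<in> disj_hull D yh (node_set D Mb Nb hb) I"
  shows "ineq_holds ineq z"
proof -
  have "(\<Union>i\<in>I. node_set D Mb Nb hb \<inter> disjunction D yh i) \<subseteq> {z. ineq_holds ineq z}"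
    using assms(1,2) by (auto simp: cg_feasible_def intro: certified_imp_ineq_holds)
  from hull_minimal[of _ _ convex, OF this convex_ineq_holds] show ?thesis
    using assms(3) by (auto simp: disj_hull_def)
qed

lemma bilevel_feasible_imp_disjunction:
  assumes rows: "\<And>j. integral_vec (fol_x D $ j)" "\<And>j. integral_vec (fol_y D $ j)"
    and rhs: "integral_vec (fol_rhs D)"
    and yh: "yh \<in> follower_poly D" "integral_vec yh"
    and z: "z \<in> bilevel_feasible D"
  shows "\<exists>j. z \<in> disjunction D yh j"
proof -
  obtain x y where xy: "z = (x, y)"
    by fastforce
  have x: "integral_vec x" and y: "y \<in> follower_optimal D x"
    using z by (auto simp: bilevel_feasible_def xy)
  show ?thesis
  proof (cases "(x, yh) \<in> follower_con D")
    case True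
    \<comment> \<open>Here \<open>yh\<close> competes with the optimal response \<open>y\<close> at
      the same \<open>x\<close>.\<close>
    then have "yh \<in> follower_feasible D x"
      using yh by (simp add: follower_feasible_def)
    then have "z \<in> disjunction D yh None"
      using y by (auto simp: follower_optimal_def disjunction_def xy)
    then show ?thesis ..
  next
    case False
    then obtain j where "fol_x D $ j \<bullet> x + fol_y D $ j \<bullet> yh < fol_rhs D $ j"
      by (auto simp: follower_con_def less_eq_vec_def matrix_vector_mul_component not_le)
    moreover have "fol_x D $ j \<bullet> x + fol_y D $ j \<bullet> yh \<in> \<int>"
      using rows x yh(2) by (intro Ints_add integral_vec_inner)
    moreover have "fol_rhs D $ j \<in> \<int>"
      using rhs by (simp add: integral_vec_def)
    ultimately have "fol_x D $ j \<bullet> x + fol_y D $ j \<bullet> yh \<le> fol_rhs D $ j - 1"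
      by (intro Ints_less_imp_le_minus_one)
    then have "z \<in> disjunction D yh (Some j)"
      by (simp add: disjunction_def xy)
    then show ?thesis ..
  qed
qed

lemma bilevel_feasible_imp_integer: "bilevel_feasible D \<subseteq> integer_points"
  by (auto simp: bilevel_feasible_def follower_optimal_def follower_feasible_def integer_points_def)

text \<open>The infimum is a lower bound whether or not it is attained; over an empty set it is
  infinite, which covers an infeasible subproblem.\<close>

lemma redundant_if_le_disj_opt:
  assumes "ereal UB \<le> disj_opt D yh P i"
  shows "redundant D yh P UB i"
  using assms unfolding redundant_def disj_opt_def le_INF_iff by (auto simp: not_less)

theorem theorem3:
  fixes D :: "('n1::finite, 'n2::finite, 'n3::finite, 'm1::finite, 'm2::finite,
               'k::finite, 'p::finite, 'r::finite) bilevel"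
    and Mb :: "real^'n1^'q::finite" and Nb :: "real^'n2^'q" and hb :: "real^'q"
    and yh :: "real^'n2" and i :: "'m2 option" and UB :: real
    and P known :: "((real^'n1) \<times> (real^'n2)) set"
  assumes "standing_assumptions D"
    and "P = node_set D Mb Nb hb"
    and "P \<subseteq> hpr_feasible D"
    and "yh \<in> follower_poly D" and "integral_vec yh"
    and "finite known" and "known \<noteq> {}" and "known \<subseteq> bilevel_feasible D"
    and "UB = Min (leader_obj D ` known)"
    and "ereal UB \<le> disj_opt D yh P i"
  shows "redundant D yh P UB i \<and>
         (\<forall>z \<in> bilevel_feasible D \<inter> P. leader_obj D z < UB \<longrightarrow>
           (\<exists>j \<in> UNIV - {i}. z \<in> disjunction D yh j) \<and> z \<in> disj_hull D yh P (UNIV - {i})) \<and>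
         (\<forall>cut \<in> cg_feasible D Mb Nb hb yh (UNIV - {i}).
           (\<forall>z \<in> disj_hull D yh P (UNIV - {i}). ineq_holds cut z) \<and>
           (\<forall>z \<in> bilevel_feasible D \<inter> P. leader_obj D z < UB \<longrightarrow> ineq_holds cut z) \<and>
           (\<forall>zs \<in> P - bilevel_feasible D. 0 < cg_objective zs cut \<longrightarrow>
              \<not> ineq_holds cut zs \<and> zs \<notin> disj_hull D yh P (UNIV - {i})))"
proof -
  let ?I = "UNIV - {i}"
  have apex: "\<And>p. block D (apex D p) = p"
    and rows: "\<And>j. integral_vec (fol_x D $ j)" "\<And>j. integral_vec (fol_y D $ j)"
    and rhs: "integral_vec (fol_rhs D)"
    using assms(1) by (auto simp: standing_assumptions_def)
  have red: "redundant D yh P UB i"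
    using assms(10) by (rule redundant_if_le_disj_opt)
  have kept: "(\<exists>j\<in>?I. z \<in> disjunction D yh j) \<and> z \<in> disj_hull D yh P ?I"
    if z: "z \<in> bilevel_feasible D \<inter> P" "leader_obj D z < UB" for z
  proof -
    obtain j where j: "z \<in> disjunction D yh j"
      using bilevel_feasible_imp_disjunction[OF rows rhs assms(4,5)] z(1) by blast
    \<comment> \<open>Redundancy speaks only of integer points, so integrality of both components
      has to be supplied first.\<close>
    have "z \<in> integer_points"
      using bilevel_feasible_imp_integer z(1) by blast
    then have "z \<notin> disjunction D yh i"
      using red z unfolding redundant_def by blast
    then have "j \<in> ?I"
      using j by auto
    moreover from this have "z \<in> disj_hull D yh P ?I"
      unfolding disj_hull_def using j z(1) by (intro hull_inc) blast
    ultimately show ?thesis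
      using j by blast
  qed
  have valid: "ineq_holds cut z"
    if "cut \<in> cg_feasible D Mb Nb hb yh ?I" "z \<in> disj_hull D yh P ?I" for cut z
    using cg_feasible_valid_on_hull[OF apex] that assms(2) by blast
  \<comment> \<open>A positive objective value is exactly the amount by which \<open>zs\<close>
    violates the cut; with \<open>valid\<close>, this places \<open>zs\<close> outside the reduced
    hull.\<close>
  have separates: "\<not> ineq_holds cut zs" if "0 < cg_objective zs cut" for cut zs
    using that by (auto simp: cg_objective_def ineq_holds_def split: prod.splits)
  show ?thesis
    using red kept valid separates by blast
qed

end
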